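(* Let $n$ be a positive integer, let $\mathcal L\subseteq[n]$, and let $m$ be the largest integer such that $[m]\subseteq\mathcal L$ (with $[0]=\emptyset$). If $m>\frac12(n-1)$, then the double path $\overrightarrow{P}_{n,\mathcal L}$ requires the nSSP.
   Context: A digraph $G$ has vertex set $V(G)=[n]$ and arc set $E(G)\subseteq [n]\times[n]$; arcs $(v,v)$ are loops. $\mathcal M(G)$ is the set of real $n\times n$ matrices $A=(a_{ij})$ with $a_{ij}\neq 0$ if and only if $(i,j)\in E(G)$. A real $n\times n$ matrix $A$ has the nSSP if the only real matrix $X$ with $A\circ X=O$ (entrywise product) and $AX^\top-X^\top A=O$ is $X=O$. $G$ requires the nSSP if every $A\in\mathcal M(G)$ has the nSSP. The double path $\overrightarrow{P}_{n,\mathcal L}$ has vertex set $[n]$ and arc set $\{(i,i+1),(i+1,i): i\in[n-1]\}\cup\{(\ell,\ell):\ell\in\mathcal L\}$. *)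

theory Defs
  imports "Graph_Theory.Pair_Digraph" "Jordan_Normal_Form.Matrix"
begin

text \<open>
  A digraph on \<open>[n]\<close> is a \<^typ>\<open>nat pair_pre_digraph\<close> with vertex set \<open>{1..n}\<close>; its order \<open>n\<close>
  is recovered as \<^term>\<open>card (pverts G)\<close>.  Matrix entries are indexed from \<open>0\<close>, so the entry
  written \<open>a\<^sub>i\<^sub>j\<close> is \<open>A $$ (i - 1, j - 1)\<close>.
\<close>

definition matrices_of :: "nat pair_pre_digraph \<Rightarrow> real mat set" where
  "matrices_of G =
     {A \<in> carrier_mat (card (pverts G)) (card (pverts G)).
        \<forall>i\<in>{1..card (pverts G)}. \<forall>j\<in>{1..card (pverts G)}.
          A $$ (i - 1, j - 1) \<noteq> 0 \<longleftrightarrow> (i, j) \<in> parcs G}"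

definition hadamard_prod :: "real mat \<Rightarrow> real mat \<Rightarrow> real mat" where
  "hadamard_prod A B = mat (dim_row A) (dim_col A) (\<lambda>(i, j). A $$ (i, j) * B $$ (i, j))"

definition nSSP :: "real mat \<Rightarrow> bool" where
  "nSSP A \<longleftrightarrow>
     square_mat A \<and>
     (\<forall>X \<in> carrier_mat (dim_row A) (dim_row A).
        hadamard_prod A X = 0\<^sub>m (dim_row A) (dim_row A) \<and>
        A * transpose_mat X - transpose_mat X * A = 0\<^sub>m (dim_row A) (dim_row A) \<longrightarrow>
        X = 0\<^sub>m (dim_row A) (dim_row A))"

definition requires_nSSP :: "nat pair_pre_digraph \<Rightarrow> bool" where
  "requires_nSSP G \<longleftrightarrow> (\<forall>A \<in> matrices_of G. nSSP A)"

definition double_path :: "nat \<Rightarrow> nat set \<Rightarrow> nat pair_pre_digraph" where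
  "double_path n L =
     \<lparr> pverts = {1..n},
       parcs = (\<Union>i\<in>{1..<n}. {(i, i + 1), (i + 1, i)}) \<union> {(l, l) | l. l \<in> L} \<rparr>"

lemma pair_fin_digraph_double_path:
  assumes "L \<subseteq> {1..n}"
  shows "pair_fin_digraph (double_path n L)"
proof -
  have "finite L" using assms finite_subset by blast
  then have "finite {(l, l) | l. l \<in> L}" by simp
  then show ?thesis
    using assms by unfold_locales (auto simp: double_path_def)
qed

end

theory Submission
  imports Defs
begin

text \<open>
  Write \<open>Y\<close> for the transpose of \<open>X\<close>, so that \<open>A\<close> and \<open>Y\<close> commute and \<open>Y\<close> vanishes next to the
  diagonal and at the first \<open>m\<close> diagonal positions.  With indices from \<open>0\<close>, the entry
  \<open>(i, j - 1)\<close> of \<open>A * Y = Y * A\<close> expresses \<open>y\<^sub>i\<^sub>j\<close> through entries of \<open>Y\<close> in the two preceding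
  columns, so the zeros propagate to all \<open>i \<le> j\<close> with \<open>i + j < 2 * m\<close>.  As \<open>n \<le> 2 * m\<close>, the first
  row of \<open>Y\<close> is zero, and then so is every row, since the rows of \<open>Y\<close> satisfy a three-term
  recurrence.
\<close>

lemma commute_sum_eq:
  fixes A Y :: "'a::comm_ring_1 mat"
  assumes "A \<in> carrier_mat n n" "Y \<in> carrier_mat n n" "A * Y = Y * A" "i < n" "j < n"
  shows "(\<Sum>k<n. A $$ (i, k) * Y $$ (k, j)) = (\<Sum>k<n. Y $$ (i, k) * A $$ (k, j))"
proof -
  have "(\<Sum>k<n. B $$ (i, k) * C $$ (k, j)) = (B * C) $$ (i, j)"
    if "B \<in> carrier_mat n n" "C \<in> carrier_mat n n" for B C :: "'a mat"
    using that assms(4,5) by (simp add: scalar_prod_def lessThan_atLeast0)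
  with assms show ?thesis by metis
qed

lemma sum_eq_single_term:
  fixes f :: "nat \<Rightarrow> 'a::comm_monoid_add"
  assumes "i < n" "\<And>k. k < n \<Longrightarrow> k \<noteq> i \<Longrightarrow> f k = 0"
  shows "(\<Sum>k<n. f k) = f i"
proof -
  have "(\<Sum>k<n. f k) = (\<Sum>k<n. if k = i then f i else 0)"
    using assms(2) by (intro sum.cong) auto
  then show ?thesis
    using assms(1) by simp
qed

text \<open>The recursion for the entry \<open>(i, j)\<close> uses only entries of earlier columns
  that lie on or above the diagonal and whose index sum is at most \<open>i + j\<close>. The bound
  \<open>2 * m\<close> is therefore inherited, and on the diagonal it reads \<open>i < m\<close>,
  the range of \<open>diag0\<close>.\<close>

lemma commute_tridiagonal_triangle_zero:
  fixes A Y :: "'a::idom mat"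
  assumes carrier: "A \<in> carrier_mat n n" "Y \<in> carrier_mat n n"
    and comm: "A * Y = Y * A"
    and tri: "\<And>i j. i < n \<Longrightarrow> j < n \<Longrightarrow> Suc i < j \<or> Suc j < i \<Longrightarrow> A $$ (i, j) = 0"
    and sub: "\<And>i. Suc i < n \<Longrightarrow> A $$ (Suc i, i) \<noteq> 0"
    and diag0: "\<And>i. i < n \<Longrightarrow> i < m \<Longrightarrow> Y $$ (i, i) = 0"
    and super0: "\<And>i. Suc i < n \<Longrightarrow> Y $$ (i, Suc i) = 0"
    and "j < n" "i \<le> j" "i + j < 2 * m"
  shows "Y $$ (i, j) = 0"
  using assms(8-10)
proof (induction j arbitrary: i rule: less_induct)
  case (less j)
  consider "i = j" | "j = Suc i" | "i + 2 \<le> j"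
    using less.prems by linarith
  then show ?case
  proof cases
    case 1
    then show ?thesis using less.prems diag0 by simp
  next
    case 2
    then show ?thesis using less.prems super0 by simp
  next
    case 3
    then obtain l where j: "j = Suc l" and il: "Suc i \<le> l"
      by (cases j) auto
    \<comment> \<open>For \<open>k \<le> Suc i\<close> the entry \<open>(k, l)\<close> is in the
      triangle: \<open>k \<le> l\<close> and \<open>k + l \<le> i + j\<close>. Larger
      \<open>k\<close> lie outside the band of \<open>A\<close>.\<close>
    have "A $$ (i, k) * Y $$ (k, l) = 0" if "k < n" for k
    proof (cases "k \<le> Suc i")
      case True
      then have "Y $$ (k, l) = 0"
        using less.prems il by (intro less.IH) (auto simp: j)
      then show ?thesis by simp
    next
      case False
      then show ?thesis using tri[of i k] that less.prems by simp
    qed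
    then have "(\<Sum>k<n. A $$ (i, k) * Y $$ (k, l)) = 0"
      by (intro sum.neutral) auto
    moreover have "(\<Sum>k<n. Y $$ (i, k) * A $$ (k, l)) = Y $$ (i, j) * A $$ (j, l)"
    proof (rule sum_eq_single_term)
      fix k assume k: "k < n" "k \<noteq> j"
      \<comment> \<open>The third case leaves \<open>k = l - 1\<close> and \<open>k = l\<close>,
        where \<open>Suc i \<le> l\<close> gives \<open>i \<le> k\<close>.\<close>
      consider "k > j" | "Suc k < l" | "l \<le> Suc k" "k < j"
        using k by linarith
      then show "Y $$ (i, k) * A $$ (k, l) = 0"
      proof cases
        case 3
        then have "Y $$ (i, k) = 0"
          using less.prems il by (intro less.IH) (auto simp: j)
        then show ?thesis by simp
      qed (use tri[of k l] k less.prems in \<open>auto simp: j\<close>)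
    qed (use less.prems in simp)
    moreover have "(\<Sum>k<n. A $$ (i, k) * Y $$ (k, l)) = (\<Sum>k<n. Y $$ (i, k) * A $$ (k, l))"
      using less.prems j by (intro commute_sum_eq[OF carrier comm]) auto
    ultimately show ?thesis
      using sub[of l] less.prems by (simp add: j)
  qed
qed

text \<open>The first unit row vector is cyclic for \<open>A\<close> acting from the right, as the
  superdiagonal has no zeros. Since \<open>Y\<close> commutes with \<open>A\<close> and kills this
  vector, it kills all rows. The induction carries this out one row at a time.\<close>

lemma commute_hessenberg_zero_if_first_row_zero:
  fixes A Y :: "'a::idom mat"
  assumes carrier: "A \<in> carrier_mat n n" "Y \<in> carrier_mat n n"
    and comm: "A * Y = Y * A"
    and hess: "\<And>i j. i < n \<Longrightarrow> j < n \<Longrightarrow> Suc i < j \<Longrightarrow> A $$ (i, j) = 0"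
    and super: "\<And>i. Suc i < n \<Longrightarrow> A $$ (i, Suc i) \<noteq> 0"
    and first: "\<And>j. j < n \<Longrightarrow> Y $$ (0, j) = 0"
  shows "Y = 0\<^sub>m n n"
proof -
  have "Y $$ (i, j) = 0" if "i < n" "j < n" for i j
    using that
  proof (induction i arbitrary: j rule: less_induct)
    case (less i)
    show ?case
    proof (cases i)
      case 0
      then show ?thesis using first less.prems by simp
    next
      case (Suc l)
      have "(\<Sum>k<n. A $$ (l, k) * Y $$ (k, j)) = A $$ (l, i) * Y $$ (i, j)"
      proof (rule sum_eq_single_term)
        fix k assume "k < n" "k \<noteq> i"
        then show "A $$ (l, k) * Y $$ (k, j) = 0"
          using hess[of l k] less.IH[of k j] less.prems Suc by (cases "k < i") auto
      qed (use less.prems in simp)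
      moreover have "(\<Sum>k<n. Y $$ (l, k) * A $$ (k, j)) = 0"
        using less.IH[of l] less.prems Suc by simp
      moreover have "(\<Sum>k<n. A $$ (l, k) * Y $$ (k, j)) = (\<Sum>k<n. Y $$ (l, k) * A $$ (k, j))"
        using less.prems Suc by (intro commute_sum_eq[OF carrier comm]) auto
      ultimately show ?thesis
        using super[of l] less.prems by (simp add: Suc)
    qed
  qed
  then show ?thesis
    using carrier by (intro eq_matI) auto
qed

lemma parcs_double_path_iff:
  "(i, j) \<in> parcs (double_path n L) \<longleftrightarrow>
     (i \<in> {1..<n} \<and> j = i + 1) \<or> (j \<in> {1..<n} \<and> i = j + 1) \<or> (i = j \<and> i \<in> L)"
  by (auto simp: double_path_def)

theorem theorem5p3:
  fixes n m :: nat and L :: "nat set"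
  assumes "n \<ge> 1"
    and "L \<subseteq> {1..n}"
    and "m = (GREATEST k. {1..k} \<subseteq> L)"
    and "real m > (real n - 1) / 2"
  shows "requires_nSSP (double_path n L)"
  unfolding requires_nSSP_def
proof
  fix A assume A: "A \<in> matrices_of (double_path n L)"
  have carrier: "A \<in> carrier_mat n n"
    using A by (simp add: matrices_of_def double_path_def)
  have arc: "A $$ (i, j) \<noteq> 0 \<longleftrightarrow> (Suc i, Suc j) \<in> parcs (double_path n L)"
    if "i < n" "j < n" for i j
  proof -
    have "\<forall>i\<in>{1..n}. \<forall>j\<in>{1..n}.
        A $$ (i - 1, j - 1) \<noteq> 0 \<longleftrightarrow> (i, j) \<in> parcs (double_path n L)"
      using A by (simp add: matrices_of_def double_path_def)
    from this[THEN bspec, of "Suc i", THEN bspec, of "Suc j"] that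
    show ?thesis by simp
  qed
  \<comment> \<open>The greatest \<open>k\<close> exists because \<open>k = 0\<close> qualifies and
    \<open>L \<subseteq> {1..n}\<close> forces \<open>k \<le> n\<close>.\<close>
  have loops: "{1..m} \<subseteq> L"
    unfolding assms(3)
  proof (rule GreatestI_nat[of _ 0 n])
    fix k assume "{1..k} \<subseteq> L"
    with assms(2) have "{1..k} \<subseteq> {1..n}" by blast
    then show "k \<le> n" by (cases k) auto
  qed simp
  have "n \<le> 2 * m"
  proof -
    have "real n < real (2 * m + 1)"
      using assms(4) by (simp add: field_simps)
    then show ?thesis by linarith
  qed
  have tri: "A $$ (i, j) = 0" if "i < n" "j < n" "Suc i < j \<or> Suc j < i" for i j
    using arc[of i j] that by (auto simp: parcs_double_path_iff)
  have super: "A $$ (i, Suc i) \<noteq> 0" and sub: "A $$ (Suc i, i) \<noteq> 0" if "Suc i < n" for i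
    using arc[of i "Suc i"] arc[of "Suc i" i] that by (auto simp: parcs_double_path_iff)
  have diag: "A $$ (i, i) \<noteq> 0" if "i < n" "i < m" for i
    using arc[of i i] that subsetD[OF loops, of "Suc i"] by (auto simp: parcs_double_path_iff)
  show "nSSP A"
    unfolding nSSP_def
  proof (intro conjI ballI impI)
    show "square_mat A" using carrier by simp
  next
    fix X
    assume "X \<in> carrier_mat (dim_row A) (dim_row A)"
      and *: "hadamard_prod A X = 0\<^sub>m (dim_row A) (dim_row A) \<and>
        A * transpose_mat X - transpose_mat X * A = 0\<^sub>m (dim_row A) (dim_row A)"
    then have X: "X \<in> carrier_mat n n"
      using carrier by simp
    define Y where "Y = transpose_mat X"
    have Y: "Y \<in> carrier_mat n n"
      using X by (simp add: Y_def)
    have comm: "A * Y = Y * A"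
    proof (rule eq_matI)
      fix i j assume "i < dim_row (Y * A)" "j < dim_col (Y * A)"
      then have ij: "i < n" "j < n" using carrier Y by auto
      have "(A * Y - Y * A) $$ (i, j) = 0"
        using * ij carrier by (simp add: Y_def)
      moreover have "(A * Y - Y * A) $$ (i, j) = (A * Y) $$ (i, j) - (Y * A) $$ (i, j)"
        using ij carrier Y by (intro index_minus_mat) auto
      ultimately show "(A * Y) $$ (i, j) = (Y * A) $$ (i, j)" by simp
    qed (use carrier Y in auto)
    \<comment> \<open>The transposition swaps the indices, so the nonzero subdiagonal of
      \<open>A\<close> yields the zero superdiagonal of \<open>Y\<close>.\<close>
    have zero: "Y $$ (j, i) = 0" if "i < n" "j < n" "A $$ (i, j) \<noteq> 0" for i j
    proof -
      have "hadamard_prod A X $$ (i, j) = 0"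
        using * that carrier by simp
      then show ?thesis
        using that carrier X by (simp add: hadamard_prod_def Y_def)
    qed
    \<comment> \<open>In row 0 the triangle condition is \<open>j < 2 * m\<close>, which holds for
      every column because \<open>n \<le> 2 * m\<close>.\<close>
    have "Y $$ (0, j) = 0" if "j < n" for j
      by (rule commute_tridiagonal_triangle_zero[OF carrier Y comm tri sub, of m])
        (use zero diag sub that \<open>n \<le> 2 * m\<close> in auto)
    then have "Y = 0\<^sub>m n n"
      using tri super by (intro commute_hessenberg_zero_if_first_row_zero[OF carrier Y comm]) auto
    then have "X = 0\<^sub>m n n"
      by (metis Y_def transpose_transpose zero_transpose_mat)
    then show "X = 0\<^sub>m (dim_row A) (dim_row A)"
      using carrier by simp
  qed
qed

end
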